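(* Let $G$ be a snark and let $u$ and $v$ be two distinct vertices of $G$. Then the following statements (i)–(iii) are equivalent: (i) $G-\{u,v\}$ is $3$-edge-colourable; (ii) $G-\{u,v\}$ admits a nowhere-zero $4$-flow; (iii) $G/\{u,v\}$ admits a nowhere-zero $4$-flow. If, in addition, $u$ and $v$ are adjacent and joined by an edge $e$, then statements (i)–(iii) are also equivalent to each of the following: (iv) $G-e$ admits a nowhere-zero $4$-flow; (v) $G/e$ admits a nowhere-zero $4$-flow; (vi) $G\sim e$ is $3$-edge-colourable.
   Context: Graphs may have parallel edges and loops, and occasionally dangling edges (edges with only one end-vertex). A snark is a connected cubic graph that admits no proper edge-colouring with three colours (equivalently, no nowhere-zero $4$-flow). For distinct vertices $u,v$ of $G$: $G-\{u,v\}$ denotes the graph obtained from $G$ by removing $u$ and $v$ but retaining the edges formerly incident with them as dangling edges (an edge between $u$ and $v$ disappears); $G/\{u,v\}$ denotes the graph obtained by identifying $u$ and $v$ into a single vertex. For an edge $e$: $G-e$ is the graph obtained by deleting $e$; $G/e$ is the graph obtained by contracting $e$; $G\sim e$ is the cubic graph obtained from $G-e$ by suppressing the two resulting vertices of degree two. A nowhere-zero $4$-flow on a graph (possibly with dangling edges) is an orientation together with an assignment of values from $\{\pm1,\pm2,\pm3\}$ to the edges such that Kirchhoff's law (inflow equals outflow) holds at every vertex; dangling edges are subject to no condition at their free end. *)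

theory Defs
  imports Main "HOL-Library.Multiset"
begin

text \<open>
  Graphs with parallel edges, loops and dangling edges. Each edge carries the multiset of its
  end-vertices: \<open>{#x, y#}\<close> for an edge between \<open>x\<close> and \<open>y\<close> (a loop if \<open>x = y\<close>) and \<open>{#x#}\<close> for a
  dangling edge at \<open>x\<close>. The empty multiset stands for a vertexless circle, which only arises when
  all vertices of a circuit are suppressed.
\<close>

record ('v, 'e) multigraph =
  verts :: "'v set"
  edges :: "'e set"
  ends :: "'e \<Rightarrow> 'v multiset"

definition finite_graph :: "('v, 'e) multigraph \<Rightarrow> bool" where
  "finite_graph G \<longleftrightarrow> finite (verts G) \<and> finite (edges G) \<and>
     (\<forall>e \<in> edges G. set_mset (ends G e) \<subseteq> verts G \<and> size (ends G e) \<le> 2)"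

definition no_dangling_edges :: "('v, 'e) multigraph \<Rightarrow> bool" where
  "no_dangling_edges G \<longleftrightarrow> (\<forall>e \<in> edges G. size (ends G e) = 2)"

definition degree :: "('v, 'e) multigraph \<Rightarrow> 'v \<Rightarrow> nat" where
  "degree G x = (\<Sum>e \<in> edges G. count (ends G e) x)"

definition cubic :: "('v, 'e) multigraph \<Rightarrow> bool" where
  "cubic G \<longleftrightarrow> (\<forall>x \<in> verts G. degree G x = 3)"

definition connected_graph :: "('v, 'e) multigraph \<Rightarrow> bool" where
  "connected_graph G \<longleftrightarrow> verts G \<noteq> {} \<and>
     (\<forall>x \<in> verts G. \<forall>y \<in> verts G. (x, y) \<in> {(a, b). \<exists>e \<in> edges G. ends G e = {#a, b#}}\<^sup>*)"

text \<open>A loop is adjacent to itself, so a graph with a loop has no proper edge-colouring.\<close>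

definition adjacent_edges :: "('v, 'e) multigraph \<Rightarrow> 'e \<Rightarrow> 'e \<Rightarrow> bool" where
  "adjacent_edges G a b \<longleftrightarrow>
     (a \<noteq> b \<and> (\<exists>x. x \<in># ends G a \<and> x \<in># ends G b)) \<or> (a = b \<and> (\<exists>x. ends G a = {#x, x#}))"

definition edge_colourable :: "nat \<Rightarrow> ('v, 'e) multigraph \<Rightarrow> bool" where
  "edge_colourable k G \<longleftrightarrow> (\<exists>c :: 'e \<Rightarrow> nat. (\<forall>e \<in> edges G. c e < k) \<and>
     (\<forall>a \<in> edges G. \<forall>b \<in> edges G. adjacent_edges G a b \<longrightarrow> c a \<noteq> c b))"

definition snark :: "('v, 'e) multigraph \<Rightarrow> bool" where
  "snark G \<longleftrightarrow> finite_graph G \<and> no_dangling_edges G \<and> connected_graph G \<and> cubic G \<and>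
     \<not> edge_colourable 3 G"

text \<open>
  An orientation gives every edge a tail and a head; \<open>None\<close> is the free end of a dangling edge,
  where Kirchhoff's law is not imposed.
\<close>

definition orientation ::
  "('v, 'e) multigraph \<Rightarrow> ('e \<Rightarrow> 'v option) \<Rightarrow> ('e \<Rightarrow> 'v option) \<Rightarrow> bool" where
  "orientation G tail head \<longleftrightarrow>
     (\<forall>e \<in> edges G. ends G e = mset_set (set_option (tail e)) + mset_set (set_option (head e)))"

definition has_nowhere_zero_flow :: "nat \<Rightarrow> ('v, 'e) multigraph \<Rightarrow> bool" where
  "has_nowhere_zero_flow k G \<longleftrightarrow> (\<exists>tail head. \<exists>f :: 'e \<Rightarrow> int.
     orientation G tail head \<and>
     (\<forall>e \<in> edges G. f e \<noteq> 0 \<and> \<bar>f e\<bar> < int k) \<and>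
     (\<forall>x \<in> verts G. (\<Sum>e | e \<in> edges G \<and> head e = Some x. f e) =
                    (\<Sum>e | e \<in> edges G \<and> tail e = Some x. f e)))"

text \<open>
  \<open>G - S\<close>: edges with just one end in \<open>S\<close> stay as dangling edges; edges with no end outside \<open>S\<close>
  (those joining members of \<open>S\<close>, and loops) disappear.
\<close>

definition remove_vertices :: "('v, 'e) multigraph \<Rightarrow> 'v set \<Rightarrow> ('v, 'e) multigraph" where
  "remove_vertices G S =
     \<lparr>verts = verts G - S,
      edges = {e \<in> edges G. \<not> set_mset (ends G e) \<subseteq> S},
      ends = (\<lambda>e. filter_mset (\<lambda>x. x \<notin> S) (ends G e))\<rparr>"

text \<open>
  \<open>G / S\<close>: an arbitrary member of \<open>S\<close> serves as the vertex into which \<open>S\<close> is identified. All edges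
  are kept; those between members of \<open>S\<close> become loops.
\<close>

definition identify_vertices :: "('v, 'e) multigraph \<Rightarrow> 'v set \<Rightarrow> ('v, 'e) multigraph" where
  "identify_vertices G S =
     (let r = (\<lambda>x. if x \<in> S then (SOME s. s \<in> S) else x) in
      \<lparr>verts = r ` verts G,
       edges = edges G,
       ends = (\<lambda>e. image_mset r (ends G e))\<rparr>)"

definition delete_edge :: "('v, 'e) multigraph \<Rightarrow> 'e \<Rightarrow> ('v, 'e) multigraph" where
  "delete_edge G e = \<lparr>verts = verts G, edges = edges G - {e}, ends = ends G\<rparr>"

definition contract_edge :: "('v, 'e) multigraph \<Rightarrow> 'e \<Rightarrow> ('v, 'e) multigraph" where
  "contract_edge G e = identify_vertices (delete_edge G e) (set_mset (ends G e))"

text \<open>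
  Suppressing a set \<open>W\<close> of vertices of degree two merges every maximal path whose inner vertices
  lie in \<open>W\<close> into one edge. The new edge is represented by the set of edges of that path; its ends
  are the ends of the path, that is, the end-vertices of its edges that lie outside \<open>W\<close>.
\<close>

definition suppress_vertices :: "('v, 'e) multigraph \<Rightarrow> 'v set \<Rightarrow> ('v, 'e set) multigraph" where
  "suppress_vertices G W =
     \<lparr>verts = verts G - W,
      edges = edges G // {(a, b). a \<in> edges G \<and> b \<in> edges G \<and>
                                  (\<exists>w \<in> W. w \<in># ends G a \<and> w \<in># ends G b)}\<^sup>*,
      ends = (\<lambda>C. \<Sum>a \<in> C. filter_mset (\<lambda>x. x \<notin> W) (ends G a))\<rparr>"

text \<open>
  \<open>G \<sim> e\<close>: if \<open>G\<close> is cubic and \<open>e\<close> is not a loop, the vertices of degree two in \<open>G - e\<close> are exactly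
  the two ends of \<open>e\<close>.
\<close>

definition delete_suppress :: "('v, 'e) multigraph \<Rightarrow> 'e \<Rightarrow> ('v, 'e set) multigraph" where
  "delete_suppress G e =
     suppress_vertices (delete_edge G e) {x \<in> verts G. degree (delete_edge G e) x = 2}"

end

theory Submission
  imports Defs
begin

text \<open>
  All six statements amount to the existence of two edge sets that cover the graph and have even
  degree at every vertex, or at every vertex other than \<open>u\<close> and \<open>v\<close>. By Tutte's argument such a
  cover exists exactly when there is a nowhere-zero 4-flow, and in a cubic graph it is the same as a
  3-edge-colouring. In a graph without dangling edges the degree sum of an edge set is even, so
  the condition at a vertex obtained by identification is automatic, and in \<open>G - e\<close> an edge set
  that is even away from the ends of \<open>e\<close> has the same parity at both ends. If that parity were odd
  for a member of the cover, adding \<open>e\<close> would turn the cover into one of the snark \<open>G\<close>.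
\<close>

subsection \<open>Integer circulations\<close>

definition arc_vector :: "'v option \<Rightarrow> 'v option \<Rightarrow> 'v \<Rightarrow> int" where
  "arc_vector a b x = of_bool (b = Some x) - of_bool (a = Some x)"

definition arc_vectors :: "('v \<Rightarrow> int) set" where
  "arc_vectors = {d. \<exists>a b. d = arc_vector a b}"

lemma arc_vector_in_arc_vectors [simp]: "arc_vector a b \<in> arc_vectors"
  by (auto simp: arc_vectors_def)

lemma
  assumes "d \<in> arc_vectors" and "d x \<noteq> 0"
  shows arc_vectors_nonzero_abs: "\<bar>d x\<bar> = 1"
    and arc_vectors_nonzero_eq: "\<exists>a. d = (\<lambda>y. d x * arc_vector a (Some x) y)"
proof -
  obtain a b where d: "d = arc_vector a b"
    using assms(1) by (auto simp: arc_vectors_def)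
  then consider "a = Some x" "b \<noteq> Some x" | "a \<noteq> Some x" "b = Some x"
    using assms(2) by (cases "a = Some x"; cases "b = Some x") (auto simp: arc_vector_def)
  then show "\<bar>d x\<bar> = 1" "\<exists>a. d = (\<lambda>y. d x * arc_vector a (Some x) y)"
    by (cases; auto simp: d arc_vector_def fun_eq_iff)+
qed

lemma arc_vectors_odd_iff:
  assumes "d \<in> arc_vectors"
  shows "odd (d x) \<longleftrightarrow> d x \<noteq> 0"
proof (cases "d x = 0")
  case False
  then have "odd \<bar>d x\<bar>"
    using arc_vectors_nonzero_abs [OF assms] by simp
  then show ?thesis
    using False by simp
qed simp

lemma arc_vectors_merge:
  assumes "d \<in> arc_vectors" and "d' \<in> arc_vectors" and "d x \<noteq> 0" and "d' x \<noteq> 0"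
  shows "(\<lambda>y. d y - d x * d' x * d' y) \<in> arc_vectors"
proof -
  obtain a where a: "d = (\<lambda>y. d x * arc_vector a (Some x) y)"
    using arc_vectors_nonzero_eq [OF assms(1,3)] by blast
  obtain b where b: "d' = (\<lambda>y. d' x * arc_vector b (Some x) y)"
    using arc_vectors_nonzero_eq [OF assms(2,4)] by blast
  have "d' x * d' x = 1"
    using arc_vectors_nonzero_abs [OF assms(2,4)] abs_mult_self_eq [of "d' x"] by simp
  have "d y - d x * d' x * d' y = d x * arc_vector a b y" for y
  proof -
    have "d y = d x * arc_vector a (Some x) y"
      by (rule fun_cong [OF a])
    moreover have "d' x * d' y = arc_vector b (Some x) y"
    proof -
      have "d' x * d' y = d' x * (d' x * arc_vector b (Some x) y)"
        by (rule arg_cong [OF fun_cong [OF b]])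
      then show ?thesis
        using \<open>d' x * d' x = 1\<close> by (simp flip: mult.assoc)
    qed
    ultimately have "d y - d x * d' x * d' y =
        d x * (arc_vector a (Some x) y - arc_vector b (Some x) y)"
      by (simp only: mult.assoc right_diff_distrib)
    then show ?thesis
      by (simp add: arc_vector_def)
  qed
  moreover from arc_vectors_nonzero_abs [OF assms(1,3)] consider "d x = 1" | "d x = - 1"
    by linarith
  then have "(\<lambda>y. d x * arc_vector a b y) \<in> arc_vectors"
  proof cases
    case 2
    then have "(\<lambda>y. d x * arc_vector a b y) = arc_vector b a"
      by (simp add: arc_vector_def fun_eq_iff)
    then show ?thesis
      by simp
  qed simp
  ultimately show ?thesis
    by simp
qed

definition circulation_on :: "'v set \<Rightarrow> 'e set \<Rightarrow> ('e \<Rightarrow> 'v \<Rightarrow> int) \<Rightarrow> ('e \<Rightarrow> int) \<Rightarrow> bool" where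
  "circulation_on U E d f \<longleftrightarrow> (\<forall>x\<in>U. (\<Sum>e\<in>E. f e * d e x) = 0)"

lemma sum_mult_merge:
  fixes d :: "'e \<Rightarrow> 'v \<Rightarrow> int"
  assumes "finite B" and "e \<in> B"
  shows "(\<Sum>a\<in>B. s a * (d(e := \<lambda>y. d e y + t * d b y)) a x) = (\<Sum>a\<in>B. s a * d a x) + s e * t * d b x"
proof -
  have "(\<Sum>a\<in>B - {e}. s a * (d(e := \<lambda>y. d e y + t * d b y)) a x) = (\<Sum>a\<in>B - {e}. s a * d a x)"
    by (rule sum.cong) auto
  then show ?thesis
    using assms by (simp add: sum.remove [of B e] algebra_simps)
qed

lemma even_sum_merge_iff:
  fixes d :: "'e \<Rightarrow> 'v \<Rightarrow> int"
  assumes "finite B" and "e \<in> B" and "b \<notin> B" and "odd t"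
  shows "even (\<Sum>a\<in>B. (d(e := \<lambda>y. d e y + t * d b y)) a x) \<longleftrightarrow> even (\<Sum>a\<in>insert b B. d a x)"
  using sum_mult_merge [OF assms(1,2), of "\<lambda>_. 1" d t b x] assms by auto

lemma sign_circulation_unmerge:
  fixes d :: "'e \<Rightarrow> 'v \<Rightarrow> int"
  assumes "finite B" and "e \<in> B" and "b \<notin> B" and "\<bar>t\<bar> = 1" and "\<forall>a. \<bar>s a\<bar> = 1"
    and "circulation_on U B (d(e := \<lambda>y. d e y + t * d b y)) s"
  shows "\<exists>s'. (\<forall>a. \<bar>s' a\<bar> = 1) \<and> circulation_on U (insert b B) d s'"
proof (intro exI conjI)
  let ?s = "s(b := s e * t)"
  show "\<forall>a. \<bar>?s a\<bar> = 1"
    using assms(4,5) by (simp add: abs_mult)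
  have "(\<Sum>a\<in>B. ?s a * d a x) = (\<Sum>a\<in>B. s a * d a x)" for x
    using assms(3) by (intro sum.cong) auto
  moreover have "(\<Sum>a\<in>B. s a * d a x) + s e * t * d b x = 0" if "x \<in> U" for x
    using assms(6) that unfolding circulation_on_def sum_mult_merge [OF assms(1,2)] by blast
  ultimately show "circulation_on U (insert b B) d ?s"
    using assms(1,3) by (simp add: circulation_on_def add.commute)
qed

lemma even_arc_sum_imp_second_arc:
  assumes "finite A" and "e \<in> A" and "d e \<in> arc_vectors" and "d e x \<noteq> 0"
    and "even (\<Sum>a\<in>A. d a x)"
  shows "\<exists>b\<in>A - {e}. d b x \<noteq> 0"
proof -
  have "odd (\<Sum>a\<in>A - {e}. d a x)"
    using assms arc_vectors_odd_iff [OF assms(3), of x] by (simp add: sum.remove)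
  then have "(\<Sum>a\<in>A - {e}. d a x) \<noteq> 0"
    by (intro notI) simp
  then show ?thesis
    by (rule sum.not_neutral_contains_not_neutral) blast
qed

text \<open>
  An Eulerian orientation, by splitting off: two arcs that meet in \<open>x\<close> are merged into one arc
  that avoids \<open>x\<close>.
\<close>

lemma even_arcs_sign_circulation:
  fixes d :: "'e \<Rightarrow> 'v \<Rightarrow> int"
  assumes "finite A" and "\<And>e. e \<in> A \<Longrightarrow> d e \<in> arc_vectors" and "\<And>x. x \<in> U \<Longrightarrow> even (\<Sum>e\<in>A. d e x)"
  shows "\<exists>s. (\<forall>e. \<bar>s e\<bar> = 1) \<and> circulation_on U A d s"
  using assms
proof (induction A arbitrary: d rule: finite_psubset_induct)
  case (psubset A)
  show ?case
  proof (cases "\<forall>e\<in>A. \<forall>x\<in>U. d e x = 0")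
    case True
    then show ?thesis
      by (intro exI [of _ "\<lambda>_. 1"]) (simp add: circulation_on_def)
  next
    case False
    then obtain e x where e: "e \<in> A" "x \<in> U" "d e x \<noteq> 0"
      by blast
    then obtain b where b: "b \<in> A - {e}" "d b x \<noteq> 0"
      using even_arc_sum_imp_second_arc
        [OF psubset.hyps e(1) psubset.prems(1) e(3) psubset.prems(2)]
      by blast
    define t where "t = - (d e x * d b x)"
    define d' where "d' = d(e := \<lambda>y. d e y + t * d b y)"
    have t: "\<bar>t\<bar> = 1"
      using e b psubset.prems(1) by (simp add: t_def abs_mult arc_vectors_nonzero_abs)
    then have "odd t"
      by presburger
    have B: "finite (A - {b})" "e \<in> A - {b}" "b \<notin> A - {b}"
      using psubset.hyps e b by auto
    have A: "insert b (A - {b}) = A"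
      using b by auto
    have "\<exists>s. (\<forall>a. \<bar>s a\<bar> = 1) \<and> circulation_on U (A - {b}) d' s"
    proof (rule psubset.IH)
      show "A - {b} \<subset> A"
        using b by blast
      have "(\<lambda>y. d e y + t * d b y) \<in> arc_vectors"
        using arc_vectors_merge [of "d e" "d b" x] psubset.prems(1) e b by (simp add: t_def)
      then show "d' a \<in> arc_vectors" if "a \<in> A - {b}" for a
        using that psubset.prems(1) by (simp add: d'_def)
      show "even (\<Sum>a\<in>A - {b}. d' a y)" if "y \<in> U" for y
        unfolding d'_def even_sum_merge_iff [OF B \<open>odd t\<close>] A by (rule psubset.prems(2) [OF that])
    qed
    then show ?thesis
      using sign_circulation_unmerge [OF B t] unfolding d'_def A by blast
  qed
qed

lemma circulation_on_even_odd_support: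
  assumes "finite E" and "circulation_on U E d f" and "x \<in> U"
  shows "even (\<Sum>e | e \<in> E \<and> odd (f e). d e x)"
proof -
  have "even (\<Sum>e\<in>E. f e * d e x)"
    using assms(2,3) by (simp add: circulation_on_def)
  moreover have "{e \<in> E. odd (f e * d e x)} = {a \<in> {e \<in> E. odd (f e)}. odd (d a x)}"
    by auto
  ultimately show ?thesis
    using assms(1) by (simp add: even_sum_iff)
qed

lemma circulation_on_add_double_iff:
  assumes "\<And>e. e \<in> E \<Longrightarrow> f e = g e + 2 * h e" and "circulation_on U E d g"
  shows "circulation_on U E d f \<longleftrightarrow> circulation_on U E d h"
proof -
  have "(\<Sum>e\<in>E. f e * d e x) = (\<Sum>e\<in>E. g e * d e x) + 2 * (\<Sum>e\<in>E. h e * d e x)" for x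
    using assms(1) by (simp add: sum.distrib sum_distrib_left algebra_simps)
  then show ?thesis
    using assms(2) by (simp add: circulation_on_def)
qed

lemma even_arcs_sign_circulation_on_superset:
  fixes d :: "'e \<Rightarrow> 'v \<Rightarrow> int"
  assumes "finite E" and "\<And>e. e \<in> E \<Longrightarrow> d e \<in> arc_vectors"
    and "\<And>x. x \<in> U \<Longrightarrow> even (\<Sum>e\<in>F. d e x)" and "F \<subseteq> E"
  shows "\<exists>g. (\<forall>e. \<bar>g e\<bar> = of_bool (e \<in> F)) \<and> circulation_on U E d g"
proof -
  obtain s where s: "\<forall>e. \<bar>s e\<bar> = 1" "circulation_on U F d s"
    using even_arcs_sign_circulation [of F d U] assms finite_subset by blast
  define g where "g e = (if e \<in> F then s e else 0)" for e
  have "(\<Sum>e\<in>E. g e * d e x) = (\<Sum>e\<in>F. s e * d e x)" for x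
    using assms by (intro sum.mono_neutral_cong_right) (auto simp: g_def)
  then have "circulation_on U E d g"
    using s(2) by (simp add: circulation_on_def)
  moreover have "\<forall>e. \<bar>g e\<bar> = of_bool (e \<in> F)"
    using s(1) by (simp add: g_def)
  ultimately show ?thesis
    by blast
qed

text \<open>
  A circulation is congruent modulo 2 to one with values \<open>0, 1, -1\<close>, and half of the difference
  is again a circulation. The odd values of the given circulation and of that half circulation
  form the two even sets.
\<close>

lemma nowhere_zero_4_circulation_imp_even_cover:
  fixes d :: "'e \<Rightarrow> 'v \<Rightarrow> int"
  assumes fin: "finite E" and arcs: "\<And>e. e \<in> E \<Longrightarrow> d e \<in> arc_vectors"
    and nz: "\<And>e. e \<in> E \<Longrightarrow> f e \<noteq> 0 \<and> \<bar>f e\<bar> < 4" and f: "circulation_on U E d f"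
  shows "\<exists>A B. A \<union> B = E \<and> (\<forall>x\<in>U. even (\<Sum>e\<in>A. d e x) \<and> even (\<Sum>e\<in>B. d e x))"
proof -
  define B where "B = {e \<in> E. odd (f e)}"
  have even_B: "even (\<Sum>e\<in>B. d e x)" if "x \<in> U" for x
    unfolding B_def using fin f that by (rule circulation_on_even_odd_support)
  have "B \<subseteq> E"
    by (auto simp: B_def)
  then obtain g where g: "\<And>e. \<bar>g e\<bar> = of_bool (e \<in> B)" "circulation_on U E d g"
    using even_arcs_sign_circulation_on_superset [OF fin arcs even_B] by metis
  define h where "h e = (f e - g e) div 2" for e
  have f_eq: "f e = g e + 2 * h e" if "e \<in> E" for e
  proof -
    have "even (g e) \<longleftrightarrow> even \<bar>g e\<bar>"
      by simp
    also have "\<dots> \<longleftrightarrow> even (f e)"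
      using g(1) [of e] that by (simp add: B_def)
    finally show ?thesis
      by (simp add: h_def)
  qed
  have h: "circulation_on U E d h"
    using circulation_on_add_double_iff [OF f_eq g(2)] f by simp
  define A where "A = {e \<in> E. odd (h e)}"
  have "even (\<Sum>e\<in>A. d e x)" if "x \<in> U" for x
    unfolding A_def using fin h that by (rule circulation_on_even_odd_support)
  moreover have "e \<in> A \<union> B" if "e \<in> E" for e
  proof (rule ccontr)
    assume "e \<notin> A \<union> B"
    then have "even (h e)" "g e = 0"
      using g(1) [of e] that by (auto simp: A_def)
    then have "4 dvd f e"
      using f_eq [OF that] by auto
    then show False
      using nz [OF that] dvd_imp_le_int [of "f e" 4] by simp
  qed
  then have "A \<union> B = E"
    by (auto simp: A_def B_def)
  ultimately show ?thesis
    using even_B by blast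
qed

lemma even_cover_imp_nowhere_zero_4_circulation:
  fixes d :: "'e \<Rightarrow> 'v \<Rightarrow> int"
  assumes fin: "finite E" and arcs: "\<And>e. e \<in> E \<Longrightarrow> d e \<in> arc_vectors" and cover: "A \<union> B = E"
    and even: "\<And>x. x \<in> U \<Longrightarrow> even (\<Sum>e\<in>A. d e x)" "\<And>x. x \<in> U \<Longrightarrow> even (\<Sum>e\<in>B. d e x)"
  shows "\<exists>f. (\<forall>e\<in>E. f e \<noteq> 0 \<and> \<bar>f e\<bar> < 4) \<and> circulation_on U E d f"
proof -
  have "A \<subseteq> E" "B \<subseteq> E"
    using cover by auto
  obtain h where h: "\<And>e. \<bar>h e\<bar> = of_bool (e \<in> A)" "circulation_on U E d h"
    using even_arcs_sign_circulation_on_superset [OF fin arcs even(1) \<open>A \<subseteq> E\<close>] by metis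
  obtain g where g: "\<And>e. \<bar>g e\<bar> = of_bool (e \<in> B)" "circulation_on U E d g"
    using even_arcs_sign_circulation_on_superset [OF fin arcs even(2) \<open>B \<subseteq> E\<close>] by metis
  have "circulation_on U E d (\<lambda>e. g e + 2 * h e)"
    using g(2) h(2) by (subst circulation_on_add_double_iff [of _ _ g h]) simp_all
  moreover have "g e + 2 * h e \<noteq> 0 \<and> \<bar>g e + 2 * h e\<bar> < 4" if "e \<in> E" for e
  proof -
    have "\<bar>g e\<bar> \<noteq> 0 \<or> \<bar>h e\<bar> \<noteq> 0" and "\<bar>g e\<bar> \<le> 1" and "\<bar>h e\<bar> \<le> 1"
      using g(1) [of e] h(1) [of e] that cover by auto
    then show ?thesis
      by presburger
  qed
  ultimately show ?thesis
    by (intro exI [of _ "\<lambda>e. g e + 2 * h e"]) simp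
qed

lemma nowhere_zero_4_circulation_iff_even_cover:
  fixes d :: "'e \<Rightarrow> 'v \<Rightarrow> int"
  assumes "finite E" and "\<And>e. e \<in> E \<Longrightarrow> d e \<in> arc_vectors"
  shows "(\<exists>f. (\<forall>e\<in>E. f e \<noteq> 0 \<and> \<bar>f e\<bar> < 4) \<and> circulation_on U E d f) \<longleftrightarrow>
    (\<exists>A B. A \<union> B = E \<and> (\<forall>x\<in>U. even (\<Sum>e\<in>A. d e x) \<and> even (\<Sum>e\<in>B. d e x)))"
    (is "?flow \<longleftrightarrow> ?cover")
proof
  assume ?flow
  then obtain f where "\<And>e. e \<in> E \<Longrightarrow> f e \<noteq> 0 \<and> \<bar>f e\<bar> < 4" "circulation_on U E d f"
    by blast
  with assms show ?cover
    by (rule nowhere_zero_4_circulation_imp_even_cover)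
next
  assume ?cover
  then obtain A B where "A \<union> B = E"
    "\<And>x. x \<in> U \<Longrightarrow> even (\<Sum>e\<in>A. d e x)" "\<And>x. x \<in> U \<Longrightarrow> even (\<Sum>e\<in>B. d e x)"
    by blast
  with assms show ?flow
    by (rule even_cover_imp_nowhere_zero_4_circulation)
qed

subsection \<open>Covers by two even edge sets\<close>

definition edge_degree :: "('v, 'e) multigraph \<Rightarrow> 'e set \<Rightarrow> 'v \<Rightarrow> nat" where
  "edge_degree G F x = (\<Sum>e\<in>F. count (ends G e) x)"

definition even_set_on :: "('v, 'e) multigraph \<Rightarrow> 'v set \<Rightarrow> 'e set \<Rightarrow> bool" where
  "even_set_on G U F \<longleftrightarrow> F \<subseteq> edges G \<and> (\<forall>x\<in>U. even (edge_degree G F x))"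

definition even_2_cover_on :: "('v, 'e) multigraph \<Rightarrow> 'v set \<Rightarrow> bool" where
  "even_2_cover_on G U \<longleftrightarrow>
     (\<exists>A B. even_set_on G U A \<and> even_set_on G U B \<and> A \<union> B = edges G)"

lemma even_2_cover_on_subset:
  assumes "U \<subseteq> V" and "even_2_cover_on G V"
  shows "even_2_cover_on G U"
proof -
  have "even_set_on G U F" if "even_set_on G V F" for F
    using that assms(1) by (auto simp: even_set_on_def)
  then show ?thesis
    using assms(2) unfolding even_2_cover_on_def by blast
qed

lemma degree_eq_edge_degree: "degree G x = edge_degree G (edges G) x"
  by (simp add: degree_def edge_degree_def)

lemma
  assumes "finite_graph G"
  shows finite_verts: "finite (verts G)"
    and finite_edges: "finite (edges G)"
    and finite_edge_subset: "F \<subseteq> edges G \<Longrightarrow> finite F"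
  using assms finite_subset by (auto simp: finite_graph_def)

lemma edge_degree_mono:
  assumes "finite F'" and "F \<subseteq> F'"
  shows "edge_degree G F x \<le> edge_degree G F' x"
  unfolding edge_degree_def using assms by (intro sum_mono2) auto

lemma edge_degree_Diff:
  assumes "finite F'" and "F \<subseteq> F'"
  shows "edge_degree G F' x = edge_degree G (F' - F) x + edge_degree G F x"
  unfolding edge_degree_def using assms by (intro sum.subset_diff)

lemma card_le_edge_degree:
  assumes "finite F" and "\<And>e. e \<in> F \<Longrightarrow> x \<in># ends G e"
  shows "card F \<le> edge_degree G F x"
  unfolding card_eq_sum edge_degree_def using assms by (intro sum_mono) simp

lemma two_le_edge_degree:
  assumes "finite F" and "a \<in> F" and "b \<in> F" and "a \<noteq> b" and "x \<in># ends G a" and "x \<in># ends G b"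
  shows "2 \<le> edge_degree G F x"
proof -
  have "card {a, b} \<le> edge_degree G {a, b} x"
    using assms by (intro card_le_edge_degree) auto
  also have "\<dots> \<le> edge_degree G F x"
    using assms by (intro edge_degree_mono) auto
  finally show ?thesis
    using assms(4) by simp
qed

lemma edge_degree_pos:
  assumes "finite F" and "a \<in> F" and "x \<in># ends G a"
  shows "edge_degree G F x > 0"
  unfolding edge_degree_def using assms by (intro sum_pos2 [of F a]) simp_all

lemma multiset_size_le_2_cases:
  assumes "size M \<le> 2"
  obtains "M = {#}" | x where "M = {#x#}" | x y where "M = {#x, y#}"
proof (cases M)
  case (add x N)
  then show thesis
    using assms that(2,3) by (cases N) auto
qed (rule that(1))

lemma orientation_exists:
  assumes "finite_graph G"
  shows "\<exists>tail head. orientation G tail head"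
proof -
  have "\<exists>t h. ends G e = mset_set (set_option t) + mset_set (set_option h)"
    if "e \<in> edges G" for e
  proof -
    have "size (ends G e) \<le> 2"
      using assms that by (simp add: finite_graph_def)
    then consider "ends G e = {#}" | x where "ends G e = {#x#}" | x y where "ends G e = {#x, y#}"
      using multiset_size_le_2_cases by blast
    then show ?thesis
    proof cases
      case 1
      then show ?thesis
        by (intro exI [of _ None]) simp
    next
      case (2 x)
      then show ?thesis
        by (intro exI [of _ None] exI [of _ "Some x"]) simp
    next
      case (3 x y)
      then show ?thesis
        by (intro exI [of _ "Some x"] exI [of _ "Some y"]) simp
    qed
  qed
  then show ?thesis
    unfolding orientation_def by metis
qed

lemma even_edge_degree_iff_even_arc_sum:
  assumes "orientation G tail head" and "finite F" and "F \<subseteq> edges G"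
  shows "even (edge_degree G F x) \<longleftrightarrow> even (\<Sum>e\<in>F. arc_vector (tail e) (head e) x)"
proof -
  have "count (mset_set (set_option a)) x = of_bool (a = Some x)" for a
    by (cases a) auto
  then have "count (ends G e) x = of_bool (tail e = Some x) + of_bool (head e = Some x)"
    if "e \<in> F" for e
    using assms(1,3) that by (auto simp: orientation_def)
  then have "{e \<in> F. odd (count (ends G e) x)} = {e \<in> F. odd (arc_vector (tail e) (head e) x)}"
    by (auto simp: arc_vector_def)
  then show ?thesis
    using assms(2) by (simp add: edge_degree_def even_sum_iff)
qed

lemma even_2_cover_on_iff_even_arc_sums:
  assumes G: "finite_graph G" and ori: "orientation G tail head"
  shows "even_2_cover_on G U \<longleftrightarrow> (\<exists>A B. A \<union> B = edges G \<and>
    (\<forall>x\<in>U. even (\<Sum>e\<in>A. arc_vector (tail e) (head e) x) \<and>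
      even (\<Sum>e\<in>B. arc_vector (tail e) (head e) x)))"
proof -
  have "even (edge_degree G F x) \<longleftrightarrow> even (\<Sum>e\<in>F. arc_vector (tail e) (head e) x)"
    if "F \<subseteq> edges G" for F x
    using even_edge_degree_iff_even_arc_sum [OF ori] finite_edge_subset [OF G] that by blast
  then show ?thesis
    unfolding even_2_cover_on_def even_set_on_def by (intro iff_exI) blast
qed

lemma Kirchhoff_iff_circulation_on:
  fixes f :: "'e \<Rightarrow> int" and tail head :: "'e \<Rightarrow> 'v option"
  assumes "finite E"
  shows "(\<forall>x\<in>U. (\<Sum>e | e \<in> E \<and> head e = Some x. f e) = (\<Sum>e | e \<in> E \<and> tail e = Some x. f e)) \<longleftrightarrow>
    circulation_on U E (\<lambda>e. arc_vector (tail e) (head e)) f"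
proof -
  have "(\<Sum>e | e \<in> E \<and> g e = Some x. f e) = (\<Sum>e\<in>E. f e * of_bool (g e = Some x))"
    for g :: "'e \<Rightarrow> 'v option" and x
    using assms by (intro sum.mono_neutral_cong_left) auto
  then show ?thesis
    by (simp add: circulation_on_def arc_vector_def right_diff_distrib sum_subtractf)
qed

text \<open>Tutte's theorem: the two even sets form a nowhere-zero \<open>\<int>\<^sub>2 \<times> \<int>\<^sub>2\<close>-flow.\<close>

theorem has_nowhere_zero_4_flow_iff_even_2_cover_on:
  assumes G: "finite_graph G"
  shows "has_nowhere_zero_flow 4 G \<longleftrightarrow> even_2_cover_on G (verts G)"
proof -
  have "has_nowhere_zero_flow 4 G \<longleftrightarrow> (\<exists>tail head. orientation G tail head \<and>
      (\<exists>f. (\<forall>e\<in>edges G. f e \<noteq> 0 \<and> \<bar>f e\<bar> < 4) \<and>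
        circulation_on (verts G) (edges G) (\<lambda>e. arc_vector (tail e) (head e)) f))"
    unfolding has_nowhere_zero_flow_def
    by (simp add: Kirchhoff_iff_circulation_on [OF finite_edges [OF G]])
  also have "\<dots> \<longleftrightarrow> (\<exists>tail head. orientation G tail head \<and> (\<exists>A B. A \<union> B = edges G \<and>
      (\<forall>x\<in>verts G. even (\<Sum>e\<in>A. arc_vector (tail e) (head e) x) \<and>
        even (\<Sum>e\<in>B. arc_vector (tail e) (head e) x))))"
    by (subst nowhere_zero_4_circulation_iff_even_cover) (simp_all add: finite_edges G)
  also have "\<dots> \<longleftrightarrow> (\<exists>tail head. orientation G tail head \<and> even_2_cover_on G (verts G))"
    by (simp add: even_2_cover_on_iff_even_arc_sums [OF G] cong: conj_cong)
  also have "\<dots> \<longleftrightarrow> even_2_cover_on G (verts G)"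
    using orientation_exists [OF G] by blast
  finally show ?thesis .
qed

subsection \<open>Three-edge-colourings of cubic graphs\<close>

lemma multiset_eq_loop_if_count_ge_2:
  assumes "size M \<le> 2" and "count M x \<ge> 2"
  shows "M = {#x, x#}"
proof -
  have "replicate_mset 2 x \<subseteq># M"
    using assms(2) by (simp add: count_le_replicate_mset_subset_eq)
  then obtain N where "M = {#x, x#} + N"
    by (auto simp: numeral_2_eq_2 subset_mset.le_iff_add)
  then show ?thesis
    using assms(1) by simp
qed

lemma edge_degree_le_1_iff:
  assumes G: "finite_graph G" and F: "F \<subseteq> edges G"
  shows "edge_degree G F x \<le> 1 \<longleftrightarrow>
    (\<forall>a\<in>F. ends G a \<noteq> {#x, x#}) \<and> (\<forall>a\<in>F. \<forall>b\<in>F. x \<in># ends G a \<and> x \<in># ends G b \<longrightarrow> a = b)"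
    (is "_ \<longleftrightarrow> ?matching")
proof
  have finF: "finite F"
    using G F by (rule finite_edge_subset)
  assume le: "edge_degree G F x \<le> 1"
  have "ends G a \<noteq> {#x, x#}" if "a \<in> F" for a
    using edge_degree_mono [OF finF, of "{a}" G x] le that by (auto simp: edge_degree_def)
  moreover have "a = b" if "a \<in> F" "b \<in> F" "x \<in># ends G a" "x \<in># ends G b" for a b
    using two_le_edge_degree [OF finF that(1,2) _ that(3,4)] le by fastforce
  ultimately show ?matching
    by blast
next
  assume matching: ?matching
  show "edge_degree G F x \<le> 1"
  proof (cases "\<exists>a\<in>F. x \<in># ends G a")
    case True
    then obtain a where a: "a \<in> F" "x \<in># ends G a"
      by blast
    have "count (ends G b) x = 0" if "b \<in> F - {a}" for b
    proof -
      have "x \<notin># ends G b"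
        using matching a that by blast
      then show ?thesis
        by (simp add: count_eq_zero_iff)
    qed
    then have "edge_degree G F x = count (ends G a) x"
      using a finite_edge_subset [OF G F] by (simp add: edge_degree_def sum.remove)
    moreover have "size (ends G a) \<le> 2"
      using G F a(1) by (auto simp: finite_graph_def)
    then have "\<not> count (ends G a) x \<ge> 2"
      using multiset_eq_loop_if_count_ge_2 [of "ends G a" x] matching a(1) by auto
    ultimately show ?thesis
      by simp
  next
    case False
    then have "edge_degree G F x = 0"
      by (simp add: edge_degree_def not_in_iff)
    then show ?thesis
      by simp
  qed
qed

lemma proper_colouring_iff_edge_degree_le_1:
  fixes c :: "'e \<Rightarrow> nat"
  assumes G: "finite_graph G"
  shows "(\<forall>a\<in>edges G. \<forall>b\<in>edges G. adjacent_edges G a b \<longrightarrow> c a \<noteq> c b) \<longleftrightarrow>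
    (\<forall>i. \<forall>x\<in>verts G. edge_degree G {e \<in> edges G. c e = i} x \<le> 1)"
    (is "?proper \<longleftrightarrow> ?matchings")
proof -
  have le_1_iff: "edge_degree G {e \<in> edges G. c e = i} x \<le> 1 \<longleftrightarrow>
      (\<forall>a\<in>edges G. c a = i \<longrightarrow> ends G a \<noteq> {#x, x#}) \<and>
      (\<forall>a\<in>edges G. \<forall>b\<in>edges G. c a = i \<and> c b = i \<and> x \<in># ends G a \<and> x \<in># ends G b \<longrightarrow> a = b)" for i x
    by (subst edge_degree_le_1_iff [OF G]) auto
  show ?thesis
  proof
    assume ?proper
    then show ?matchings
      unfolding le_1_iff adjacent_edges_def by metis
  next
    assume matchings: ?matchings
    show ?proper
    proof (intro ballI impI notI)
      fix a b
      assume ab: "a \<in> edges G" "b \<in> edges G" "adjacent_edges G a b" "c a = c b"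
      then obtain x where x: "x \<in># ends G a" "x \<in># ends G b" "a \<noteq> b \<or> ends G a = {#x, x#}"
        by (auto simp: adjacent_edges_def)
      then have "x \<in> verts G"
        using G ab(1) by (auto simp: finite_graph_def)
      then have "edge_degree G {e \<in> edges G. c e = c a} x \<le> 1"
        using matchings by blast
      then show False
        unfolding le_1_iff using ab x by metis
    qed
  qed
qed

text \<open>In a cubic graph two even sets that cover all edges are the unions of two colour classes.\<close>

lemma even_2_cover_on_imp_edge_colourable:
  assumes G: "finite_graph G" and cubic: "cubic G" and cover: "even_2_cover_on G (verts G)"
  shows "edge_colourable 3 G"
proof -
  obtain A B where AB: "even_set_on G (verts G) A" "even_set_on G (verts G) B" "A \<union> B = edges G"
    using cover by (auto simp: even_2_cover_on_def)
  define c :: "_ \<Rightarrow> nat" where "c e = (if e \<notin> A then 0 else if e \<notin> B then 1 else 2)" for e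
  have fin: "finite A" "finite B" "finite (edges G)"
    using AB(3) finite_edges [OF G] by (auto simp flip: AB(3))
  have "edge_degree G {e \<in> edges G. c e = i} x \<le> 1" if x: "x \<in> verts G" for i x
  proof -
    define p q r where "p = edge_degree G (edges G - A) x" and "q = edge_degree G (edges G - B) x"
      and "r = edge_degree G (A \<inter> B) x"
    have "A - A \<inter> B = edges G - B" "B - A \<inter> B = edges G - A"
      using AB(3) by auto
    then have deg: "edge_degree G A x = q + r" "edge_degree G B x = p + r"
      using edge_degree_Diff [of A "A \<inter> B" G x] edge_degree_Diff [of B "A \<inter> B" G x] fin
      by (simp_all add: p_def q_def r_def)
    moreover have "edge_degree G (edges G) x = 3"
      using cubic x by (simp add: cubic_def degree_eq_edge_degree)
    ultimately have "p + q + r = 3"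
      using edge_degree_Diff [of "edges G" A G x] AB(1) fin(3) by (simp add: p_def even_set_on_def)
    moreover have "even (q + r)" "even (p + r)"
      using AB(1,2) x deg by (auto simp: even_set_on_def)
    ultimately have "p = 1" "q = 1" "r = 1"
      by presburger+
    moreover have "{e \<in> edges G. c e = i} =
        (if i = 0 then edges G - A else if i = 1 then edges G - B else if i = 2 then A \<inter> B else {})"
      using AB(3) by (auto simp: c_def)
    ultimately show ?thesis
      by (simp add: p_def q_def r_def edge_degree_def)
  qed
  moreover have "c e < 3" for e
    by (simp add: c_def)
  ultimately show ?thesis
    unfolding edge_colourable_def proper_colouring_iff_edge_degree_le_1 [OF G] by blast
qed

lemma edge_colourable_imp_even_2_cover_on:
  assumes G: "finite_graph G" and cubic: "cubic G" and "edge_colourable 3 G"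
  shows "even_2_cover_on G (verts G)"
proof -
  obtain c :: "_ \<Rightarrow> nat" where c: "\<forall>e\<in>edges G. c e < 3"
    and le: "\<And>i x. x \<in> verts G \<Longrightarrow> edge_degree G {e \<in> edges G. c e = i} x \<le> 1"
    using assms(3)
    unfolding edge_colourable_def proper_colouring_iff_edge_degree_le_1 [OF G] by blast
  let ?K = "\<lambda>i. {e \<in> edges G. c e = i}"
  have "even_set_on G (verts G) (edges G - ?K i)" if i: "i < 3" for i
    unfolding even_set_on_def
  proof (intro conjI ballI)
    fix x
    assume x: "x \<in> verts G"
    have "(\<Sum>j<3. edge_degree G (?K j) x) = edge_degree G (edges G) x"
      unfolding edge_degree_def
      using c finite_edges [OF G] by (intro sum.group) auto
    also have "\<dots> = 3"
      using cubic x by (simp add: cubic_def degree_eq_edge_degree)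
    finally have "edge_degree G (?K 0) x + edge_degree G (?K 1) x + edge_degree G (?K 2) x = 3"
      by (simp add: eval_nat_numeral)
    then have "edge_degree G (?K i) x = 1"
      using le [OF x, of 0] le [OF x, of 1] le [OF x, of 2] i
      by (auto simp: less_Suc_eq eval_nat_numeral)
    then show "even (edge_degree G (edges G - ?K i) x)"
      using edge_degree_Diff [of "edges G" "?K i" G x] \<open>edge_degree G (edges G) x = 3\<close>
        finite_edges [OF G] by auto
  qed auto
  then have "even_set_on G (verts G) (edges G - ?K 0)" "even_set_on G (verts G) (edges G - ?K 1)"
    by simp_all
  moreover have "(edges G - ?K 0) \<union> (edges G - ?K 1) = edges G"
    by auto
  ultimately show ?thesis
    unfolding even_2_cover_on_def by blast
qed

theorem edge_colourable_3_iff_even_2_cover_on: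
  assumes "finite_graph G" and "cubic G"
  shows "edge_colourable 3 G \<longleftrightarrow> even_2_cover_on G (verts G)"
  using assms edge_colourable_imp_even_2_cover_on even_2_cover_on_imp_edge_colourable by blast

subsection \<open>Removing and identifying vertices\<close>

lemma remove_vertices_sel [simp]:
  "verts (remove_vertices G S) = verts G - S"
  "edges (remove_vertices G S) = {e \<in> edges G. \<not> set_mset (ends G e) \<subseteq> S}"
  "ends (remove_vertices G S) e = filter_mset (\<lambda>x. x \<notin> S) (ends G e)"
  by (simp_all add: remove_vertices_def)

lemma finite_graph_remove_vertices:
  assumes "finite_graph G"
  shows "finite_graph (remove_vertices G S)"
  using assms by (auto simp: finite_graph_def intro: le_trans [OF size_filter_mset_lesseq])

lemma edge_degree_remove_vertices:
  assumes "finite F" and "F \<subseteq> edges G" and "x \<notin> S"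
  shows "edge_degree (remove_vertices G S) (F \<inter> edges (remove_vertices G S)) x = edge_degree G F x"
  unfolding edge_degree_def
  using assms by (intro sum.mono_neutral_cong_left) (auto simp: count_eq_zero_iff)

lemma cubic_remove_vertices:
  assumes "finite_graph G" and "\<And>x. x \<in> verts G - S \<Longrightarrow> degree G x = 3"
  shows "cubic (remove_vertices G S)"
proof -
  have "degree (remove_vertices G S) x = degree G x" if "x \<notin> S" for x
    using edge_degree_remove_vertices [of "edges G" G x S] that finite_edges [OF assms(1)]
    by (simp add: degree_eq_edge_degree Int_absorb1 Collect_conj_eq [symmetric])
  then show ?thesis
    using assms(2) by (simp add: cubic_def)
qed

lemma even_set_on_remove_vertices_iff:
  assumes "finite_graph G" and "F \<subseteq> edges G" and "U \<inter> S = {}"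
  shows "even_set_on (remove_vertices G S) U (F \<inter> edges (remove_vertices G S)) \<longleftrightarrow> even_set_on G U F"
  using assms edge_degree_remove_vertices [of F G _ S] finite_edge_subset [OF assms(1,2)]
  by (simp add: even_set_on_def disjoint_iff)

text \<open>The edges that disappear in \<open>G - S\<close> may be added to either set.\<close>

lemma even_2_cover_on_remove_vertices_iff:
  assumes G: "finite_graph G"
  shows "even_2_cover_on (remove_vertices G S) (verts G - S) \<longleftrightarrow> even_2_cover_on G (verts G - S)"
    (is "even_2_cover_on ?H ?U \<longleftrightarrow> _")
proof
  assume "even_2_cover_on ?H ?U"
  then obtain A B where AB: "even_set_on ?H ?U A" "even_set_on ?H ?U B" "A \<union> B = edges ?H"
    by (auto simp: even_2_cover_on_def)
  let ?A = "A \<union> (edges G - edges ?H)"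
  have sub: "A \<subseteq> edges ?H" "B \<subseteq> edges ?H" "edges ?H \<subseteq> edges G"
    using AB(3) by auto
  then have "?A \<inter> edges ?H = A" "B \<inter> edges ?H = B" "?A \<subseteq> edges G" "B \<subseteq> edges G" "?A \<union> B = edges G"
    using AB(3) by blast+
  then show "even_2_cover_on G ?U"
    unfolding even_2_cover_on_def
    using AB(1,2) even_set_on_remove_vertices_iff [OF G, of _ ?U S]
    by (metis Diff_disjoint Int_commute)
next
  assume "even_2_cover_on G ?U"
  then obtain A B where AB: "even_set_on G ?U A" "even_set_on G ?U B" "A \<union> B = edges G"
    by (auto simp: even_2_cover_on_def)
  have "even_set_on ?H ?U (F \<inter> edges ?H)" if "even_set_on G ?U F" for F
    using even_set_on_remove_vertices_iff [OF G, of F ?U S] that by (auto simp: even_set_on_def)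
  moreover have "(A \<inter> edges ?H) \<union> (B \<inter> edges ?H) = edges ?H"
    using AB(3) by auto
  ultimately show "even_2_cover_on ?H ?U"
    unfolding even_2_cover_on_def using AB(1,2) by blast
qed

lemma sum_count_eq_size:
  assumes "finite V" and "set_mset M \<subseteq> V"
  shows "(\<Sum>x\<in>V. count M x) = size M"
  unfolding size_multiset_overloaded_eq
  using assms by (intro sum.mono_neutral_right) (auto simp: count_eq_zero_iff)

lemma even_sum_edge_degree:
  assumes G: "finite_graph G" and nd: "no_dangling_edges G" and F: "F \<subseteq> edges G"
  shows "even (\<Sum>x\<in>verts G. edge_degree G F x)"
proof -
  have "(\<Sum>x\<in>verts G. edge_degree G F x) = (\<Sum>e\<in>F. \<Sum>x\<in>verts G. count (ends G e) x)"
    unfolding edge_degree_def by (rule sum.swap)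
  also have "\<dots> = (\<Sum>e\<in>F. 2)"
    using G nd F
    by (intro sum.cong) (auto simp: sum_count_eq_size finite_graph_def no_dangling_edges_def)
  finally show ?thesis
    by simp
qed

lemma even_set_on_imp_even_sum_edge_degree:
  assumes G: "finite_graph G" and nd: "no_dangling_edges G" and S: "S \<subseteq> verts G"
    and F: "even_set_on G (verts G - S) F"
  shows "even (\<Sum>x\<in>S. edge_degree G F x)"
proof -
  have "(\<Sum>x\<in>verts G. edge_degree G F x) =
      (\<Sum>x\<in>verts G - S. edge_degree G F x) + (\<Sum>x\<in>S. edge_degree G F x)"
    using S finite_verts [OF G] by (intro sum.subset_diff)
  moreover have "even (\<Sum>x\<in>verts G. edge_degree G F x)"
    using G nd F by (intro even_sum_edge_degree) (auto simp: even_set_on_def)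
  moreover have "even (\<Sum>x\<in>verts G - S. edge_degree G F x)"
    using F by (intro dvd_sum) (simp add: even_set_on_def)
  ultimately show ?thesis
    by simp
qed

definition representative :: "'v set \<Rightarrow> 'v \<Rightarrow> 'v" where
  "representative S x = (if x \<in> S then SOME s. s \<in> S else x)"

lemma identify_vertices_sel [simp]:
  "verts (identify_vertices G S) = representative S ` verts G"
  "edges (identify_vertices G S) = edges G"
  "ends (identify_vertices G S) e = image_mset (representative S) (ends G e)"
  by (simp_all add: identify_vertices_def representative_def [abs_def] Let_def)

lemma finite_graph_identify_vertices:
  assumes "finite_graph G"
  shows "finite_graph (identify_vertices G S)"
  using assms by (auto simp: finite_graph_def)

lemma edge_degree_identify_vertices:
  assumes G: "finite_graph G" and F: "F \<subseteq> edges G"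
  shows "edge_degree (identify_vertices G S) F y =
    (\<Sum>x | x \<in> verts G \<and> representative S x = y. edge_degree G F x)"
proof -
  have "count (image_mset (representative S) (ends G e)) y =
      (\<Sum>x | x \<in> verts G \<and> representative S x = y. count (ends G e) x)"
    if "e \<in> F" for e
  proof -
    have "set_mset (ends G e) \<subseteq> verts G"
      using G F that by (auto simp: finite_graph_def)
    then show ?thesis
      unfolding count_image_mset using finite_verts [OF G]
      by (intro sum.mono_neutral_left) (auto simp: count_eq_zero_iff)
  qed
  then show ?thesis
    unfolding edge_degree_def by (subst sum.swap) simp
qed

lemma even_set_on_identify_vertices_iff:
  assumes G: "finite_graph G" and nd: "no_dangling_edges G" and S: "S \<subseteq> verts G" "S \<noteq> {}"
  shows "even_set_on (identify_vertices G S) (verts (identify_vertices G S)) F \<longleftrightarrow>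
    even_set_on G (verts G - S) F"
    (is "even_set_on ?H _ F \<longleftrightarrow> _")
proof (cases "F \<subseteq> edges G")
  case True
  obtain s where s: "s \<in> S" "\<And>x. representative S x = (if x \<in> S then s else x)"
    using some_in_eq [of S] S(2) by (auto simp: representative_def)
  have "verts ?H = insert s (verts G - S)"
    using S s by auto
  moreover have "{x \<in> verts G. representative S x = s} = S"
    using S s by auto
  then have "edge_degree ?H F s = (\<Sum>x\<in>S. edge_degree G F x)"
    by (simp add: edge_degree_identify_vertices [OF G True])
  moreover have "edge_degree ?H F x = edge_degree G F x" if "x \<in> verts G - S" for x
  proof -
    have "{y \<in> verts G. representative S y = x} = {x}"
      using that s by auto
    then show ?thesis
      by (simp add: edge_degree_identify_vertices [OF G True])
  qed
  ultimately show ?thesis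
    using True even_set_on_imp_even_sum_edge_degree [OF G nd S(1), of F]
    by (auto simp: even_set_on_def)
qed (simp add: even_set_on_def)

lemma even_2_cover_on_identify_vertices_iff:
  assumes "finite_graph G" and "no_dangling_edges G" and "S \<subseteq> verts G" and "S \<noteq> {}"
  shows "even_2_cover_on (identify_vertices G S) (verts (identify_vertices G S)) \<longleftrightarrow>
    even_2_cover_on G (verts G - S)"
  unfolding even_2_cover_on_def even_set_on_identify_vertices_iff [OF assms]
  by simp

subsection \<open>Deleting an edge\<close>

lemma delete_edge_sel [simp]:
  "verts (delete_edge G e) = verts G"
  "edges (delete_edge G e) = edges G - {e}"
  "ends (delete_edge G e) = ends G"
  by (simp_all add: delete_edge_def)

lemma finite_graph_delete_edge: "finite_graph G \<Longrightarrow> finite_graph (delete_edge G e)"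
  by (simp add: finite_graph_def)

lemma no_dangling_edges_delete_edge: "no_dangling_edges G \<Longrightarrow> no_dangling_edges (delete_edge G e)"
  by (simp add: no_dangling_edges_def)

lemma degree_delete_edge:
  assumes "finite_graph G" and "e \<in> edges G"
  shows "degree G x = degree (delete_edge G e) x + count (ends G e) x"
  using assms by (simp add: finite_graph_def degree_def sum.remove)

lemma remove_vertices_delete_edge:
  assumes "set_mset (ends G e) \<subseteq> S"
  shows "remove_vertices (delete_edge G e) S = remove_vertices G S"
  using assms by (auto simp: remove_vertices_def)

lemma even_2_cover_on_delete_incident_edge_iff:
  assumes G: "finite_graph G" and e: "set_mset (ends G e) \<subseteq> S"
  shows "even_2_cover_on (delete_edge G e) (verts G - S) \<longleftrightarrow> even_2_cover_on G (verts G - S)"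
  using even_2_cover_on_remove_vertices_iff [OF finite_graph_delete_edge [OF G], of e S]
    even_2_cover_on_remove_vertices_iff [OF G, of S] remove_vertices_delete_edge [OF e]
  by simp

lemma even_set_on_delete_edge_iff:
  "even_set_on (delete_edge G e) U F \<longleftrightarrow> even_set_on G U F \<and> e \<notin> F"
  by (auto simp: even_set_on_def edge_degree_def)

lemma even_set_on_or_insert_edge:
  assumes G: "finite_graph G" and nd: "no_dangling_edges G"
    and e: "e \<in> edges G" "ends G e = {#u, v#}" "u \<noteq> v"
    and F: "even_set_on G (verts G - {u, v}) F" "e \<notin> F"
  shows "even_set_on G (verts G) F \<or> even_set_on G (verts G) (insert e F)"
proof -
  have "{u, v} \<subseteq> verts G"
    using G e(1,2) by (auto simp: finite_graph_def)
  then have "even (edge_degree G F u + edge_degree G F v)"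
    using even_set_on_imp_even_sum_edge_degree [OF G nd _ F(1)] e(3) by simp
  moreover have "edge_degree G (insert e F) x = count (ends G e) x + edge_degree G F x" for x
    using finite_edge_subset [OF G, of F] F by (simp add: edge_degree_def even_set_on_def)
  ultimately show ?thesis
    using F(1) e by (cases "even (edge_degree G F u)") (auto simp: even_set_on_def)
qed

lemma even_2_cover_on_delete_edge_iff:
  assumes G: "finite_graph G" and nd: "no_dangling_edges G" and no: "\<not> even_2_cover_on G (verts G)"
    and e: "e \<in> edges G" "ends G e = {#u, v#}" "u \<noteq> v"
  shows "even_2_cover_on (delete_edge G e) (verts G - {u, v}) \<longleftrightarrow>
    even_2_cover_on (delete_edge G e) (verts G)"
    (is "even_2_cover_on ?D _ \<longleftrightarrow> _")
proof
  assume "even_2_cover_on ?D (verts G - {u, v})"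
  then obtain A B
    where off: "even_set_on G (verts G - {u, v}) A" "even_set_on G (verts G - {u, v}) B"
    and "e \<notin> A" "e \<notin> B" and cover: "A \<union> B = edges G - {e}"
    by (auto simp: even_2_cover_on_def even_set_on_delete_edge_iff)
  have "even_set_on G (verts G) A \<and> even_set_on G (verts G) B"
  proof (rule ccontr)
    assume "\<not> ?thesis"
    then consider "\<not> even_set_on G (verts G) A" | "\<not> even_set_on G (verts G) B"
      by blast
    moreover obtain A' where "A' = A \<or> A' = insert e A" "even_set_on G (verts G) A'"
      using even_set_on_or_insert_edge [OF G nd e off(1) \<open>e \<notin> A\<close>] by blast
    moreover obtain B' where "B' = B \<or> B' = insert e B" "even_set_on G (verts G) B'"
      using even_set_on_or_insert_edge [OF G nd e off(2) \<open>e \<notin> B\<close>] by blast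
    ultimately have "A' \<union> B' = insert e (A \<union> B)"
      by cases auto
    then have "A' \<union> B' = edges G"
      using cover e(1) by auto
    then show False
      using no \<open>even_set_on G (verts G) A'\<close> \<open>even_set_on G (verts G) B'\<close>
      unfolding even_2_cover_on_def by blast
  qed
  then show "even_2_cover_on ?D (verts G)"
    using cover \<open>e \<notin> A\<close> \<open>e \<notin> B\<close> by (auto simp: even_2_cover_on_def even_set_on_delete_edge_iff)
qed (rule even_2_cover_on_subset [OF Diff_subset])

subsection \<open>Suppressing vertices of degree two\<close>

definition meets :: "('v, 'e) multigraph \<Rightarrow> 'v set \<Rightarrow> ('e \<times> 'e) set" where
  "meets G W = {(a, b). a \<in> edges G \<and> b \<in> edges G \<and> (\<exists>w\<in>W. w \<in># ends G a \<and> w \<in># ends G b)}"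

lemma suppress_vertices_sel [simp]:
  "verts (suppress_vertices G W) = verts G - W"
  "edges (suppress_vertices G W) = edges G // (meets G W)\<^sup>*"
  "ends (suppress_vertices G W) C = (\<Sum>a\<in>C. filter_mset (\<lambda>x. x \<notin> W) (ends G a))"
  by (simp_all add: suppress_vertices_def meets_def)

lemma equiv_rtrancl_meets: "equiv UNIV ((meets G W)\<^sup>*)"
proof -
  have "sym (meets G W)"
    by (auto simp: sym_def meets_def)
  then show ?thesis
    by (intro equivI refl_rtrancl sym_rtrancl trans_rtrancl) auto
qed

lemma rtrancl_Image_singleton_subset:
  assumes "a \<in> F" and "R `` F \<subseteq> F"
  shows "R\<^sup>* `` {a} \<subseteq> F"
proof -
  have "R\<^sup>* `` {a} \<subseteq> R\<^sup>* `` F"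
    using assms(1) by (intro Image_mono) auto
  also have "\<dots> = F"
    by (rule Image_closed_trancl [OF assms(2)])
  finally show ?thesis .
qed

lemma rtrancl_Image_singleton_induct [consumes 1, case_names singleton insert]:
  assumes "finite (R\<^sup>* `` {a})" and "P {a}"
    and "\<And>T p q. T \<subseteq> R\<^sup>* `` {a} \<Longrightarrow> P T \<Longrightarrow> p \<in> T \<Longrightarrow> q \<notin> T \<Longrightarrow> (p, q) \<in> R \<Longrightarrow> P (insert q T)"
  shows "P (R\<^sup>* `` {a})"
proof -
  define \<T> where "\<T> = {T. a \<in> T \<and> T \<subseteq> R\<^sup>* `` {a} \<and> P T}"
  have "\<T> \<subseteq> Pow (R\<^sup>* `` {a})"
    by (auto simp: \<T>_def)
  then have "finite \<T>"
    by (rule finite_subset) (simp add: assms(1))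
  moreover have "{a} \<in> \<T>"
    using assms(2) by (simp add: \<T>_def)
  ultimately obtain T where T: "T \<in> \<T>" and max: "\<And>T'. T' \<in> \<T> \<Longrightarrow> T \<subseteq> T' \<Longrightarrow> T = T'"
    using finite_has_maximal [of \<T>] by blast
  have "R `` T \<subseteq> T"
  proof (rule ccontr)
    assume "\<not> R `` T \<subseteq> T"
    then obtain p q where pq: "p \<in> T" "q \<notin> T" "(p, q) \<in> R"
      by blast
    moreover have "(a, p) \<in> R\<^sup>*"
      using T pq(1) by (auto simp: \<T>_def)
    then have "(a, q) \<in> R\<^sup>*"
      using pq(3) by (rule rtrancl_into_rtrancl)
    ultimately have "insert q T \<in> \<T>"
      using T assms(3) [of T p q] by (simp add: \<T>_def)
    then have "T = insert q T"
      by (rule max) blast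
    then show False
      using pq(2) by blast
  qed
  then have "R\<^sup>* `` {a} = T"
    using rtrancl_Image_singleton_subset [of a T R] T by (auto simp: \<T>_def)
  then show ?thesis
    using T by (simp add: \<T>_def)
qed

lemma suppressed_edge_subset:
  assumes "C \<in> edges G // (meets G W)\<^sup>*"
  shows "C \<subseteq> edges G"
proof -
  obtain a where "a \<in> edges G" "C = (meets G W)\<^sup>* `` {a}"
    using assms by (rule quotientE)
  then show ?thesis
    using rtrancl_Image_singleton_subset [of a "edges G" "meets G W"] by (auto simp: meets_def)
qed

lemma Union_suppressed_edges: "\<Union> (edges G // (meets G W)\<^sup>*) = edges G"
proof
  show "\<Union> (edges G // (meets G W)\<^sup>*) \<subseteq> edges G"
    using suppressed_edge_subset by blast
  show "edges G \<subseteq> \<Union> (edges G // (meets G W)\<^sup>*)"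
    by (auto simp: quotient_def)
qed

definition junctions :: "('v, 'e) multigraph \<Rightarrow> 'v set \<Rightarrow> 'e set \<Rightarrow> 'v set" where
  "junctions G W F = {w \<in> W. \<exists>a\<in>F. \<exists>b\<in>F. a \<noteq> b \<and> w \<in># ends G a \<and> w \<in># ends G b}"

lemma junctionsI:
  "w \<in> W \<Longrightarrow> a \<in> F \<Longrightarrow> b \<in> F \<Longrightarrow> a \<noteq> b \<Longrightarrow> w \<in># ends G a \<Longrightarrow> w \<in># ends G b \<Longrightarrow>
    w \<in> junctions G W F"
  by (auto simp: junctions_def)

lemma junctionsE:
  assumes "w \<in> junctions G W F"
  obtains a b where "w \<in> W" "a \<in> F" "b \<in> F" "a \<noteq> b" "w \<in># ends G a" "w \<in># ends G b"
  using assms unfolding junctions_def by blast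

lemma junctions_mono: "F \<subseteq> F' \<Longrightarrow> junctions G W F \<subseteq> junctions G W F'"
  by (auto elim!: junctionsE intro: junctionsI)

lemma finite_junctions:
  assumes "finite_graph G" and "F \<subseteq> edges G"
  shows "finite (junctions G W F)"
proof (rule finite_subset)
  show "junctions G W F \<subseteq> verts G"
    using assms by (auto simp: junctions_def finite_graph_def)
qed (rule finite_verts [OF assms(1)])

lemma card_junctions_less_insert:
  assumes G: "finite_graph G" and w: "w \<in> W" "degree G w \<le> 2"
    and T: "T \<subseteq> edges G" and p: "p \<in> T" "w \<in># ends G p"
    and q: "q \<in> edges G" "q \<notin> T" "w \<in># ends G q"
  shows "card (junctions G W T) < card (junctions G W (insert q T))"
proof (rule psubset_card_mono)
  show "finite (junctions G W (insert q T))"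
    using T q(1) by (intro finite_junctions G) simp
  have "w \<notin> junctions G W T"
  proof
    assume "w \<in> junctions G W T"
    then obtain b d where bd: "b \<in> T" "d \<in> T" "b \<noteq> d" "w \<in># ends G b" "w \<in># ends G d"
      by (rule junctionsE)
    then have "card {b, d, q} \<le> edge_degree G {b, d, q} w"
      using q(3) by (intro card_le_edge_degree) auto
    also have "\<dots> \<le> degree G w"
      unfolding degree_eq_edge_degree
      using bd T q(1) finite_edges [OF G] by (intro edge_degree_mono) auto
    finally have "card {b, d, q} \<le> 2"
      using w(2) by simp
    moreover have "b \<noteq> q" "d \<noteq> q"
      using bd q(2) by auto
    ultimately show False
      using bd(3) by simp
  qed
  moreover have "w \<in> junctions G W (insert q T)"
    using w(1) p q by (intro junctionsI [of w W p _ q]) auto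
  moreover have "junctions G W T \<subseteq> junctions G W (insert q T)"
    by (rule junctions_mono) blast
  ultimately show "junctions G W T \<subset> junctions G W (insert q T)"
    by blast
qed

text \<open>
  The merged path is grown edge by edge: since no three edges meet in a suppressed vertex, each new
  edge creates a new junction.
\<close>

lemma card_suppressed_edge_le:
  assumes G: "finite_graph G" and W: "\<And>w. w \<in> W \<Longrightarrow> degree G w \<le> 2"
    and C: "C \<in> edges G // (meets G W)\<^sup>*"
  shows "card C \<le> Suc (card (junctions G W C))"
proof -
  obtain a where a: "a \<in> edges G" "C = (meets G W)\<^sup>* `` {a}"
    using C by (rule quotientE)
  have C_sub: "C \<subseteq> edges G"
    using C by (rule suppressed_edge_subset)
  have "finite ((meets G W)\<^sup>* `` {a})"
    using finite_edge_subset [OF G C_sub] by (simp add: a(2))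
  then show ?thesis
    unfolding a(2)
  proof (induction rule: rtrancl_Image_singleton_induct)
    case (insert T p q)
    obtain w where w: "w \<in> W" "w \<in># ends G p" "w \<in># ends G q" and q: "q \<in> edges G"
      using insert.hyps(4) by (auto simp: meets_def)
    have "T \<subseteq> edges G"
      using insert.hyps(1) C_sub a(2) by blast
    then have "card (junctions G W T) < card (junctions G W (insert q T))"
      using card_junctions_less_insert [OF G w(1) W] w q insert.hyps(2,3) by simp
    then show ?case
      using insert.IH insert.hyps(3) finite_edge_subset [OF G \<open>T \<subseteq> edges G\<close>] by simp
  qed simp
qed

lemma sum_count_le_size:
  assumes "finite V"
  shows "(\<Sum>x\<in>V. count M x) \<le> size M"
proof -
  have "(\<Sum>x\<in>V. count M x) \<le> (\<Sum>x\<in>V \<union> set_mset M. count M x)"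
    using assms by (intro sum_mono2) auto
  then show ?thesis
    using assms by (simp add: sum_count_eq_size)
qed

text \<open>
  Of the at most \<open>2 * card C\<close> ends of the edges of a merged path \<open>C\<close>, at least
  \<open>2 * (card C - 1)\<close> lie at its junctions.
\<close>

lemma size_ends_suppress_vertices_le_2:
  assumes G: "finite_graph G" and W: "\<And>w. w \<in> W \<Longrightarrow> degree G w \<le> 2"
    and C: "C \<in> edges G // (meets G W)\<^sup>*"
  shows "size (ends (suppress_vertices G W) C) \<le> 2"
proof -
  let ?J = "junctions G W C"
  have sub: "C \<subseteq> edges G"
    using C by (rule suppressed_edge_subset)
  have finJ: "finite ?J"
    using G sub by (rule finite_junctions)
  have "2 \<le> edge_degree G C w" if w: "w \<in> ?J" for w
  proof -
    obtain a b where "a \<in> C" "b \<in> C" "a \<noteq> b" "w \<in># ends G a" "w \<in># ends G b"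
      using w by (rule junctionsE)
    with finite_edge_subset [OF G sub] show ?thesis
      by (rule two_le_edge_degree)
  qed
  then have "2 * card ?J \<le> (\<Sum>w\<in>?J. edge_degree G C w)"
    using sum_bounded_below [of ?J 2 "edge_degree G C"] by (simp add: mult.commute)
  also have "\<dots> = (\<Sum>a\<in>C. \<Sum>w\<in>?J. count (ends G a) w)"
    unfolding edge_degree_def by (rule sum.swap)
  also have "\<dots> = (\<Sum>a\<in>C. \<Sum>w\<in>?J. count (filter_mset (\<lambda>x. x \<in> W) (ends G a)) w)"
    by (intro sum.cong) (auto simp: junctions_def)
  also have "\<dots> \<le> (\<Sum>a\<in>C. size (filter_mset (\<lambda>x. x \<in> W) (ends G a)))"
    by (intro sum_mono sum_count_le_size finJ)
  finally have "2 * card ?J + size (ends (suppress_vertices G W) C) \<le>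
      (\<Sum>a\<in>C. size (filter_mset (\<lambda>x. x \<in> W) (ends G a))) +
      (\<Sum>a\<in>C. size (filter_mset (\<lambda>x. x \<notin> W) (ends G a)))"
    by simp
  also have "\<dots> = (\<Sum>a\<in>C. size (ends G a))"
    unfolding sum.distrib [symmetric] size_union [symmetric] multiset_partition [symmetric] ..
  also have "\<dots> \<le> 2 * card C"
    using G sub sum_bounded_above [of C "\<lambda>a. size (ends G a)" 2]
    by (auto simp: finite_graph_def mult.commute)
  also have "\<dots> \<le> 2 * Suc (card ?J)"
    using card_suppressed_edge_le [OF G W C] by simp
  finally show ?thesis
    by simp
qed

lemma finite_graph_suppress_vertices:
  assumes G: "finite_graph G" and W: "\<And>w. w \<in> W \<Longrightarrow> degree G w \<le> 2"
  shows "finite_graph (suppress_vertices G W)"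
proof -
  have "edges G // (meets G W)\<^sup>* \<subseteq> Pow (edges G)"
    using suppressed_edge_subset by blast
  then have "finite (edges G // (meets G W)\<^sup>*)"
    by (rule finite_subset) (simp add: finite_edges [OF G])
  moreover have "set_mset (ends (suppress_vertices G W) C) \<subseteq> verts G - W"
    if "C \<in> edges G // (meets G W)\<^sup>*" for C
  proof
    fix x
    assume "x \<in># ends (suppress_vertices G W) C"
    moreover have "C \<subseteq> edges G" "finite C"
      using suppressed_edge_subset [OF that] finite_edge_subset [OF G] by auto
    ultimately obtain a where "a \<in> edges G" "x \<in># ends G a" "x \<notin> W"
      by (auto simp: set_mset_sum)
    then show "x \<in> verts G - W"
      using G by (auto simp: finite_graph_def)
  qed
  ultimately show ?thesis
    using size_ends_suppress_vertices_le_2 [OF G W] finite_verts [OF G]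
    unfolding finite_graph_def by (auto simp del: suppress_vertices_sel(3))
qed

lemma edge_degree_suppress_vertices:
  assumes G: "finite_graph G" and \<C>: "\<C> \<subseteq> edges (suppress_vertices G W)" and x: "x \<notin> W"
  shows "edge_degree (suppress_vertices G W) \<C> x = edge_degree G (\<Union>\<C>) x"
proof -
  have C: "C \<in> edges G // (meets G W)\<^sup>*" "C \<in> UNIV // (meets G W)\<^sup>*" if "C \<in> \<C>" for C
    using \<C> that by (auto simp: quotient_def)
  have "edge_degree (suppress_vertices G W) \<C> x = (\<Sum>C\<in>\<C>. \<Sum>a\<in>C. count (ends G a) x)"
    using x by (simp add: edge_degree_def count_sum)
  also have "\<dots> = (\<Sum>a\<in>\<Union>\<C>. count (ends G a) x)"
  proof (rule sum.Union_disjoint [unfolded comp_def, symmetric])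
    show "\<forall>C\<in>\<C>. finite C"
      using finite_edge_subset [OF G suppressed_edge_subset] C(1) by auto
    show "\<forall>C\<in>\<C>. \<forall>D\<in>\<C>. C \<noteq> D \<longrightarrow> C \<inter> D = {}"
      using quotient_disj [OF equiv_rtrancl_meets C(2) C(2)] by auto
  qed
  finally show ?thesis
    by (simp add: edge_degree_def)
qed

lemma degree_suppress_vertices:
  assumes "finite_graph G" and "x \<notin> W"
  shows "degree (suppress_vertices G W) x = degree G x"
  using edge_degree_suppress_vertices [OF assms(1) subset_refl assms(2)]
  by (simp add: degree_eq_edge_degree Union_suppressed_edges)

lemma even_2_cover_on_suppress_verticesD:
  assumes G: "finite_graph G" and "even_2_cover_on (suppress_vertices G W) (verts G - W)"
  shows "even_2_cover_on G (verts G - W)"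
proof -
  let ?Q = "suppress_vertices G W" and ?U = "verts G - W"
  obtain \<A> \<B> where AB: "even_set_on ?Q ?U \<A>" "even_set_on ?Q ?U \<B>" "\<A> \<union> \<B> = edges ?Q"
    using assms(2) by (auto simp only: even_2_cover_on_def)
  have "even_set_on G ?U (\<Union>\<C>)" if "even_set_on ?Q ?U \<C>" for \<C>
    using that edge_degree_suppress_vertices [OF G, of \<C> W] Union_suppressed_edges [of G W]
    unfolding even_set_on_def by auto
  moreover have "\<Union>\<A> \<union> \<Union>\<B> = edges G"
    using AB(3) Union_suppressed_edges [of G W] by (simp flip: Union_Un_distrib)
  ultimately show ?thesis
    unfolding even_2_cover_on_def using AB(1,2) by blast
qed

lemma even_set_degree_2_closed:
  assumes G: "finite_graph G" and F: "F \<subseteq> edges G" "even (edge_degree G F w)" "degree G w = 2"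
    and a: "a \<in> F" "w \<in># ends G a" and b: "b \<in> edges G" "w \<in># ends G b"
  shows "b \<in> F"
proof (rule ccontr)
  assume "b \<notin> F"
  then have "edge_degree G (edges G - F) w > 0"
    using b finite_edges [OF G] by (intro edge_degree_pos [of _ b]) auto
  moreover have "edge_degree G F w > 0"
    using a finite_edge_subset [OF G F(1)] by (intro edge_degree_pos [of _ a])
  then have "edge_degree G F w \<ge> 2"
    using F(2) by (simp add: dvd_imp_le)
  moreover have "2 = edge_degree G (edges G - F) w + edge_degree G F w"
    using edge_degree_Diff [OF finite_edges [OF G] F(1), of G w] F(3)
    by (simp add: degree_eq_edge_degree)
  ultimately show False
    by linarith
qed

lemma even_set_on_suppressed_edge_subset:
  assumes G: "finite_graph G" and W: "\<And>w. w \<in> W \<Longrightarrow> w \<in> verts G \<and> degree G w = 2"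
    and F: "even_set_on G (verts G) F" and a: "a \<in> F"
  shows "(meets G W)\<^sup>* `` {a} \<subseteq> F"
proof (rule rtrancl_Image_singleton_subset [OF a], rule subsetI, erule ImageE)
  fix p q
  assume p: "p \<in> F" and "(p, q) \<in> meets G W"
  then obtain w where w: "w \<in> W" "w \<in># ends G p" "w \<in># ends G q" and "q \<in> edges G"
    by (auto simp: meets_def)
  moreover have "F \<subseteq> edges G" "even (edge_degree G F w)" "degree G w = 2"
    using F W [OF w(1)] by (auto simp: even_set_on_def)
  ultimately show "q \<in> F"
    using even_set_degree_2_closed [OF G] p by metis
qed

lemma even_set_on_suppress_vertices:
  assumes G: "finite_graph G" and W: "\<And>w. w \<in> W \<Longrightarrow> w \<in> verts G \<and> degree G w = 2"
    and F: "even_set_on G (verts G) F"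
  shows "even_set_on (suppress_vertices G W) (verts G - W)
    {C \<in> edges (suppress_vertices G W). C \<subseteq> F}"
proof -
  let ?\<C> = "{C \<in> edges (suppress_vertices G W). C \<subseteq> F}"
  have "F \<subseteq> \<Union> ?\<C>"
  proof
    fix a
    assume "a \<in> F"
    moreover from this F have "(meets G W)\<^sup>* `` {a} \<in> edges (suppress_vertices G W)"
      by (auto simp: even_set_on_def intro: quotientI)
    ultimately show "a \<in> \<Union> ?\<C>"
      using even_set_on_suppressed_edge_subset [OF assms] by blast
  qed
  then have "\<Union> ?\<C> = F"
    by blast
  then show ?thesis
    using F edge_degree_suppress_vertices [OF G, of ?\<C> W] by (simp add: even_set_on_def)
qed

lemma even_2_cover_on_suppress_verticesI:
  assumes G: "finite_graph G" and W: "\<And>w. w \<in> W \<Longrightarrow> w \<in> verts G \<and> degree G w = 2"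
    and cover: "even_2_cover_on G (verts G)"
  shows "even_2_cover_on (suppress_vertices G W) (verts G - W)"
proof -
  let ?Q = "suppress_vertices G W"
  obtain A B where AB: "even_set_on G (verts G) A" "even_set_on G (verts G) B" "A \<union> B = edges G"
    using cover by (auto simp: even_2_cover_on_def)
  have "C \<subseteq> A \<or> C \<subseteq> B" if "C \<in> edges ?Q" for C
  proof -
    obtain a where "a \<in> A \<union> B" and C: "C = (meets G W)\<^sup>* `` {a}"
      using \<open>C \<in> edges ?Q\<close> AB(3) by (auto elim!: quotientE)
    have "C \<subseteq> F" if "even_set_on G (verts G) F" "a \<in> F" for F
      unfolding C using G W that by (rule even_set_on_suppressed_edge_subset)
    then show ?thesis
      using AB(1,2) \<open>a \<in> A \<union> B\<close> by blast
  qed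
  then have "{C \<in> edges ?Q. C \<subseteq> A} \<union> {C \<in> edges ?Q. C \<subseteq> B} = edges ?Q"
    by blast
  then show ?thesis
    unfolding even_2_cover_on_def using even_set_on_suppress_vertices [OF G W] AB(1,2) by blast
qed

subsection \<open>Removing two vertices of a snark\<close>

lemma edge_colourable_remove_vertices_iff:
  assumes G: "finite_graph G" and "\<And>x. x \<in> verts G - S \<Longrightarrow> degree G x = 3"
  shows "edge_colourable 3 (remove_vertices G S) \<longleftrightarrow> even_2_cover_on G (verts G - S)"
  using edge_colourable_3_iff_even_2_cover_on [OF finite_graph_remove_vertices [OF G]
      cubic_remove_vertices [OF assms]] even_2_cover_on_remove_vertices_iff [OF G]
  by simp

lemma has_nowhere_zero_4_flow_remove_vertices_iff:
  assumes G: "finite_graph G"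
  shows "has_nowhere_zero_flow 4 (remove_vertices G S) \<longleftrightarrow> even_2_cover_on G (verts G - S)"
  using has_nowhere_zero_4_flow_iff_even_2_cover_on [OF finite_graph_remove_vertices [OF G]]
    even_2_cover_on_remove_vertices_iff [OF G]
  by simp

lemma has_nowhere_zero_4_flow_identify_vertices_iff:
  assumes G: "finite_graph G" and "no_dangling_edges G" and "S \<subseteq> verts G" and "S \<noteq> {}"
  shows "has_nowhere_zero_flow 4 (identify_vertices G S) \<longleftrightarrow> even_2_cover_on G (verts G - S)"
  using has_nowhere_zero_4_flow_iff_even_2_cover_on [OF finite_graph_identify_vertices [OF G]]
    even_2_cover_on_identify_vertices_iff [OF assms]
  by simp

lemma edge_colourable_suppress_vertices_iff:
  assumes G: "finite_graph G" and W: "\<And>w. w \<in> W \<Longrightarrow> degree G w = 2"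
    and "\<And>x. x \<in> verts G - W \<Longrightarrow> degree G x = 3"
  shows "edge_colourable 3 (suppress_vertices G W) \<longleftrightarrow>
    even_2_cover_on (suppress_vertices G W) (verts G - W)"
proof -
  have "finite_graph (suppress_vertices G W)"
    using G W by (intro finite_graph_suppress_vertices) simp_all
  moreover have "cubic (suppress_vertices G W)"
    using assms(3) by (simp add: cubic_def degree_suppress_vertices [OF G])
  ultimately show ?thesis
    by (simp add: edge_colourable_3_iff_even_2_cover_on)
qed

lemma snark_not_even_2_cover_on:
  assumes "snark G"
  shows "\<not> even_2_cover_on G (verts G)"
  using assms edge_colourable_3_iff_even_2_cover_on by (auto simp: snark_def)

lemma degree_delete_edge_cubic:
  assumes "finite_graph G" and "cubic G" and "e \<in> edges G" and "ends G e = {#u, v#}" and "u \<noteq> v"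
    and "x \<in> verts G"
  shows "degree (delete_edge G e) x = (if x \<in> {u, v} then 2 else 3)"
  using degree_delete_edge [OF assms(1,3), of x] assms by (auto simp: cubic_def)

lemma delete_suppress_eq_suppress_vertices:
  assumes G: "finite_graph G" "cubic G" and e: "e \<in> edges G" "ends G e = {#u, v#}" "u \<noteq> v"
  shows "delete_suppress G e = suppress_vertices (delete_edge G e) {u, v}"
proof -
  have "{u, v} \<subseteq> verts G"
    using G(1) e by (auto simp: finite_graph_def)
  then have "{x \<in> verts G. degree (delete_edge G e) x = 2} = {u, v}"
    using degree_delete_edge_cubic [OF G e] by (auto split: if_splits)
  then show ?thesis
    by (simp add: delete_suppress_def)
qed

lemma snark_even_2_cover_on_delete_edge_iff:
  assumes "snark G" and "e \<in> edges G" and "ends G e = {#u, v#}" and "u \<noteq> v"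
  shows "even_2_cover_on (delete_edge G e) (verts G) \<longleftrightarrow> even_2_cover_on G (verts G - {u, v})"
  using even_2_cover_on_delete_edge_iff [OF _ _ snark_not_even_2_cover_on assms(2-4)]
    even_2_cover_on_delete_incident_edge_iff [of G e "{u, v}"] assms
  by (simp add: snark_def)

lemma has_nowhere_zero_4_flow_delete_edge_iff:
  assumes "snark G" and "e \<in> edges G" and "ends G e = {#u, v#}" and "u \<noteq> v"
  shows "has_nowhere_zero_flow 4 (delete_edge G e) \<longleftrightarrow> even_2_cover_on G (verts G - {u, v})"
  using has_nowhere_zero_4_flow_iff_even_2_cover_on [OF finite_graph_delete_edge, of G e]
    snark_even_2_cover_on_delete_edge_iff [OF assms] assms(1)
  by (simp add: snark_def)

lemma has_nowhere_zero_4_flow_contract_edge_iff: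
  assumes G: "finite_graph G" "no_dangling_edges G" and e: "e \<in> edges G"
  shows "has_nowhere_zero_flow 4 (contract_edge G e) \<longleftrightarrow>
    even_2_cover_on G (verts G - set_mset (ends G e))"
proof -
  have "set_mset (ends G e) \<subseteq> verts G" "set_mset (ends G e) \<noteq> {}"
    using G e by (auto simp: finite_graph_def no_dangling_edges_def)
  then have "has_nowhere_zero_flow 4 (contract_edge G e) \<longleftrightarrow>
      even_2_cover_on (delete_edge G e) (verts G - set_mset (ends G e))"
    unfolding contract_edge_def
    using has_nowhere_zero_4_flow_identify_vertices_iff [OF finite_graph_delete_edge [OF G(1)]
        no_dangling_edges_delete_edge [OF G(2)], of "set_mset (ends G e)" e]
    by simp
  then show ?thesis
    by (simp add: even_2_cover_on_delete_incident_edge_iff [OF G(1)])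
qed

lemma edge_colourable_delete_suppress_iff:
  assumes "snark G" and e: "e \<in> edges G" "ends G e = {#u, v#}" "u \<noteq> v"
  shows "edge_colourable 3 (delete_suppress G e) \<longleftrightarrow> even_2_cover_on G (verts G - {u, v})"
proof -
  let ?D = "delete_edge G e" and ?off = "verts G - {u, v}"
  have G: "finite_graph G" "cubic G"
    using assms(1) by (simp_all add: snark_def)
  have D: "finite_graph ?D"
    using G(1) by (rule finite_graph_delete_edge)
  have uv: "{u, v} \<subseteq> verts G"
    using G(1) e by (auto simp: finite_graph_def)
  note deg = degree_delete_edge_cubic [OF G e]
  have "edge_colourable 3 (delete_suppress G e) \<longleftrightarrow>
      even_2_cover_on (suppress_vertices ?D {u, v}) ?off"
    unfolding delete_suppress_eq_suppress_vertices [OF G e]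
    using deg uv by (subst edge_colourable_suppress_vertices_iff [OF D]) auto
  also have "\<dots> \<longleftrightarrow> even_2_cover_on G ?off"
  proof
    assume "even_2_cover_on (suppress_vertices ?D {u, v}) ?off"
    then have "even_2_cover_on ?D ?off"
      using even_2_cover_on_suppress_verticesD [OF D] by simp
    then show "even_2_cover_on G ?off"
      using even_2_cover_on_delete_incident_edge_iff [OF G(1)] e(2) by simp
  next
    assume "even_2_cover_on G ?off"
    then have "even_2_cover_on ?D (verts ?D)"
      using snark_even_2_cover_on_delete_edge_iff [OF assms] by simp
    then have "even_2_cover_on (suppress_vertices ?D {u, v}) (verts ?D - {u, v})"
      using deg uv by (intro even_2_cover_on_suppress_verticesI D) auto
    then show "even_2_cover_on (suppress_vertices ?D {u, v}) ?off"
      by simp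
  qed
  finally show ?thesis .
qed

theorem theorem3:
  fixes G :: "('v, 'e) multigraph" and u v :: 'v
  assumes "snark G" and "u \<in> verts G" and "v \<in> verts G" and "u \<noteq> v"
  shows "((edge_colourable 3 (remove_vertices G {u, v}) \<longleftrightarrow>
            has_nowhere_zero_flow 4 (remove_vertices G {u, v})) \<and>
          (edge_colourable 3 (remove_vertices G {u, v}) \<longleftrightarrow>
            has_nowhere_zero_flow 4 (identify_vertices G {u, v}))) \<and>
         (\<forall>e \<in> edges G. ends G e = {#u, v#} \<longrightarrow>
           (edge_colourable 3 (remove_vertices G {u, v}) \<longleftrightarrow>
             has_nowhere_zero_flow 4 (delete_edge G e)) \<and>
           (edge_colourable 3 (remove_vertices G {u, v}) \<longleftrightarrow>
             has_nowhere_zero_flow 4 (contract_edge G e)) \<and>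
           (edge_colourable 3 (remove_vertices G {u, v}) \<longleftrightarrow>
             edge_colourable 3 (delete_suppress G e)))"
proof -
  let ?off = "verts G - {u, v}"
  have G: "finite_graph G" "no_dangling_edges G" "cubic G"
    using assms(1) by (simp_all add: snark_def)
  have "edge_colourable 3 (remove_vertices G {u, v}) \<longleftrightarrow> even_2_cover_on G ?off"
    using G(3) by (intro edge_colourable_remove_vertices_iff G) (simp add: cubic_def)
  moreover have "has_nowhere_zero_flow 4 (remove_vertices G {u, v}) \<longleftrightarrow> even_2_cover_on G ?off"
    using G(1) by (rule has_nowhere_zero_4_flow_remove_vertices_iff)
  moreover have "has_nowhere_zero_flow 4 (identify_vertices G {u, v}) \<longleftrightarrow> even_2_cover_on G ?off"
    using assms(2,3) by (intro has_nowhere_zero_4_flow_identify_vertices_iff G) auto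
  moreover have "has_nowhere_zero_flow 4 (delete_edge G e) \<longleftrightarrow> even_2_cover_on G ?off"
    if "e \<in> edges G" "ends G e = {#u, v#}" for e
    using assms(1) that assms(4) by (rule has_nowhere_zero_4_flow_delete_edge_iff)
  moreover have "has_nowhere_zero_flow 4 (contract_edge G e) \<longleftrightarrow> even_2_cover_on G ?off"
    if "e \<in> edges G" "ends G e = {#u, v#}" for e
    using has_nowhere_zero_4_flow_contract_edge_iff [OF G(1,2) that(1)] that(2) by simp
  moreover have "edge_colourable 3 (delete_suppress G e) \<longleftrightarrow> even_2_cover_on G ?off"
    if "e \<in> edges G" "ends G e = {#u, v#}" for e
    using assms(1) that assms(4) by (rule edge_colourable_delete_suppress_iff)
  ultimately show ?thesis
    by simp
qed

end
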